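(* Let $\Phi\in\mathbb{K}^{n\times m}$ be a frame for $\mathbb{K}^n$. Then any sparsest dual frame $\Psi$ of $\Phi$ satisfies $$\|\Psi\|_0=\sum_{j=1}^n \mathrm{spark}_j(\Phi).$$
   Context: $\mathbb{K}$ denotes $\mathbb{R}$ or $\mathbb{C}$. A frame for $\mathbb{K}^n$ with $m$ vectors is a family $(\phi_i)_{i=1}^m$ in $\mathbb{K}^n$ for which there are constants $0<A\le B$ with $A\|x\|_2^2\le\sum_{i=1}^m|\langle x,\phi_i\rangle|^2\le B\|x\|_2^2$ for all $x\in\mathbb{K}^n$; it is identified with the $n\times m$ matrix $\Phi$ whose columns are the $\phi_i$. A dual frame of $\Phi$ is a frame $\Psi\in\mathbb{K}^{n\times m}$ for $\mathbb{K}^n$ with $\Psi\Phi^*=I_n$ (equivalently $\Phi\Psi^*=I_n$). $\|\Psi\|_0$ denotes the number of nonzero entries of $\Psi$. A sparsest dual of $\Phi$ is a dual frame minimizing $\|\Psi\|_0$ among all dual frames of $\Phi$. $\Phi^{(j)}\in\mathbb{K}^{(n-1)\times m}$ is the matrix $\Phi$ with its $j$th row deleted. $\mathrm{spark}_j(\Phi)$ is the smallest cardinality of an index set $S\subset\{1,\dots,m\}$ such that the columns of $\Phi^{(j)}$ indexed by $S$ are linearly dependent (as an indexed family) while the corresponding columns of $\Phi$ indexed by $S$ are linearly independent. *)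

theory Defs
  imports
    "Jordan_Normal_Form.Schur_Decomposition"
    "HOL-Analysis.L2_Norm"
begin

text \<open>
  Rows and columns are indexed from 0. The definitions are polymorphic in the scalars so that they
  can be used for both \<open>real\<close> and \<open>complex\<close>, where \<open>conjugate\<close> (hence \<open>mat_adjoint\<close> and
  the inner product \<open>\<bullet>c\<close>, which conjugates its second argument) is the identity
  and \<open>cnj\<close>, respectively.
\<close>

definition is_frame :: "nat \<Rightarrow> nat \<Rightarrow> 'a :: {real_normed_field, conjugatable_field} mat \<Rightarrow> bool" where
  "is_frame n m \<Phi> \<longleftrightarrow> \<Phi> \<in> carrier_mat n m \<and>
     (\<exists>A B :: real. 0 < A \<and> A \<le> B \<and>
       (\<forall>x \<in> carrier_vec n.
          A * (L2_set (\<lambda>i. norm (x $ i)) {..<n})\<^sup>2 \<le> (\<Sum>k<m. (norm (x \<bullet>c col \<Phi> k))\<^sup>2) \<and>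
          (\<Sum>k<m. (norm (x \<bullet>c col \<Phi> k))\<^sup>2) \<le> B * (L2_set (\<lambda>i. norm (x $ i)) {..<n})\<^sup>2))"

definition is_dual_frame ::
    "nat \<Rightarrow> nat \<Rightarrow> 'a :: {real_normed_field, conjugatable_field} mat \<Rightarrow> 'a mat \<Rightarrow> bool" where
  "is_dual_frame n m \<Phi> \<Psi> \<longleftrightarrow> is_frame n m \<Psi> \<and> \<Psi> * mat_adjoint \<Phi> = 1\<^sub>m n"

definition num_nonzero :: "'a :: zero mat \<Rightarrow> nat" where
  "num_nonzero A = card {(i, k). i < dim_row A \<and> k < dim_col A \<and> A $$ (i, k) \<noteq> 0}"

definition is_sparsest_dual ::
    "nat \<Rightarrow> nat \<Rightarrow> 'a :: {real_normed_field, conjugatable_field} mat \<Rightarrow> 'a mat \<Rightarrow> bool" where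
  "is_sparsest_dual n m \<Phi> \<Psi> \<longleftrightarrow> is_arg_min num_nonzero (is_dual_frame n m \<Phi>) \<Psi>"

text \<open>\<open>insert_index j\<close> enumerates the naturals other than \<open>j\<close> in increasing order.\<close>

definition delete_row :: "'a mat \<Rightarrow> nat \<Rightarrow> 'a mat" where
  "delete_row A j = mat (dim_row A - 1) (dim_col A) (\<lambda>(i, k). A $$ (insert_index j i, k))"

text \<open>
  Independence of the columns indexed by \<open>S\<close> as an indexed family (so repeated columns are
  dependent). The vanishing of the linear combination is stated entrywise; in particular, in a
  matrix without rows every nonempty family of columns is dependent.
\<close>

definition lin_indep_columns :: "'a :: field mat \<Rightarrow> nat set \<Rightarrow> bool" where
  "lin_indep_columns A S \<longleftrightarrow>
     (\<forall>c. (\<forall>i < dim_row A. (\<Sum>k\<in>S. c k * A $$ (i, k)) = 0) \<longrightarrow> (\<forall>k\<in>S. c k = 0))"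

text \<open>
  The least element exists whenever the columns of \<open>A\<close> span and \<open>j\<close> is one of its row indices, as
  for any frame: take for \<open>S\<close> the indices of a basis among the columns.
\<close>

definition spark_at :: "nat \<Rightarrow> 'a :: field mat \<Rightarrow> nat" where
  "spark_at j A = (LEAST s. \<exists>S \<subseteq> {..<dim_col A}. card S = s \<and>
     \<not> lin_indep_columns (delete_row A j) S \<and> lin_indep_columns A S)"

end

theory Submission
  imports Defs
begin

text \<open>
  The equation \<open>\<Psi> * mat_adjoint \<Phi> = 1\<^sub>m n\<close> decouples into one linear system per row of \<open>\<Psi>\<close>: the
  conjugate of row \<open>j\<close> must be a coefficient family representing the unit vector \<open>e\<^sub>j\<close> in the columns of
  \<open>\<Phi>\<close>. A representation of \<open>e\<^sub>j\<close> on a minimal index set uses independent columns of \<open>\<Phi>\<close>, and it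
  witnesses dependence once row \<open>j\<close> is deleted; conversely, such a dependence gives a nonzero multiple
  of \<open>e\<^sub>j\<close>. Hence the smallest possible number of nonzero entries in row \<open>j\<close> is the spark. Rows can be
  minimised independently, because any solution \<open>\<Psi>\<close> of the equation is automatically a frame.
\<close>

section \<open>Deleting a row and independence of columns\<close>

lemma delete_row_index [simp]:
  "dim_row (delete_row A j) = dim_row A - 1"
  "dim_col (delete_row A j) = dim_col A"
  "i < dim_row A - 1 \<Longrightarrow> k < dim_col A \<Longrightarrow> delete_row A j $$ (i, k) = A $$ (insert_index j i, k)"
  by (auto simp: delete_row_def)

lemma all_insert_index_iff:
  assumes "j < n"
  shows "(\<forall>i < n - 1. P (insert_index j i)) \<longleftrightarrow> (\<forall>i < n. i \<noteq> j \<longrightarrow> P i)"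
proof
  assume *: "\<forall>i < n - 1. P (insert_index j i)"
  show "\<forall>i < n. i \<noteq> j \<longrightarrow> P i"
  proof (intro allI impI)
    fix i assume i: "i < n" "i \<noteq> j"
    show "P i"
    proof (cases "i < j")
      case True
      then show ?thesis using *[rule_format, of i] assms i by (simp add: insert_index_def)
    next
      case False
      with i have "i - 1 < n - 1" "insert_index j (i - 1) = i"
        by (auto simp: insert_index_def)
      then show ?thesis using *[rule_format, of "i - 1"] by simp
    qed
  qed
next
  assume "\<forall>i < n. i \<noteq> j \<longrightarrow> P i"
  then show "\<forall>i < n - 1. P (insert_index j i)"
    using assms by (auto simp: insert_index_def)
qed

text \<open>Deleting row \<open>j\<close> amounts to ignoring equation \<open>j\<close> of the
  homogeneous system. In this form no shifted index has to be handled later.\<close>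

lemma lin_indep_columns_delete_row:
  assumes "j < dim_row A" "S \<subseteq> {..<dim_col A}"
  shows "lin_indep_columns (delete_row A j) S \<longleftrightarrow>
    (\<forall>c. (\<forall>i < dim_row A. i \<noteq> j \<longrightarrow> (\<Sum>k\<in>S. c k * A $$ (i, k)) = 0) \<longrightarrow> (\<forall>k\<in>S. c k = 0))"
proof -
  have "(\<Sum>k\<in>S. c k * delete_row A j $$ (i, k)) = (\<Sum>k\<in>S. c k * A $$ (insert_index j i, k))"
    if "i < dim_row A - 1" for c i
    using that assms(2) by (intro sum.cong) auto
  then show ?thesis
    unfolding lin_indep_columns_def all_insert_index_iff[OF assms(1), symmetric] by simp
qed

section \<open>Representations of a unit vector in the columns, and the spark\<close>

definition represents_unit :: "'a :: field mat \<Rightarrow> nat \<Rightarrow> nat set \<Rightarrow> (nat \<Rightarrow> 'a) \<Rightarrow> bool" where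
  "represents_unit A j S c \<longleftrightarrow>
     (\<forall>i < dim_row A. (\<Sum>k\<in>S. c k * A $$ (i, k)) = (if i = j then 1 else 0))"

text \<open>As long as the columns used are dependent, a nontrivial relation among them can
  eliminate one of them from the representation. As \<open>S\<close> is finite, this stops at an
  independent family.\<close>

lemma represents_unit_imp_independent:
  fixes A :: "'a :: field mat"
  assumes "finite S" "represents_unit A j S c"
  obtains T d where "T \<subseteq> S" "represents_unit A j T d" "lin_indep_columns A T"
proof -
  have "\<exists>T d. T \<subseteq> S \<and> represents_unit A j T d \<and> lin_indep_columns A T"
    using assms
  proof (induction S arbitrary: c rule: finite_psubset_induct)
    case (psubset S)
    show ?case
    proof (cases "lin_indep_columns A S")
      case True
      with psubset.prems show ?thesis by blast
    next
      case False
      then obtain b l where b: "\<forall>i < dim_row A. (\<Sum>k\<in>S. b k * A $$ (i, k)) = 0"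
        and l: "l \<in> S" "b l \<noteq> 0"
        unfolding lin_indep_columns_def by blast
      define d where "d k = c k - c l / b l * b k" for k
      have "(\<Sum>k\<in>S - {l}. d k * A $$ (i, k)) = (if i = j then 1 else 0)" if i: "i < dim_row A" for i
      proof -
        have "(\<Sum>k\<in>S - {l}. d k * A $$ (i, k)) = (\<Sum>k\<in>S. d k * A $$ (i, k))"
          using l psubset.hyps by (simp add: sum.remove[of S l] d_def)
        also have "\<dots> = (\<Sum>k\<in>S. c k * A $$ (i, k)) - c l / b l * (\<Sum>k\<in>S. b k * A $$ (i, k))"
          by (simp add: d_def algebra_simps sum_subtractf sum_distrib_left)
        finally show ?thesis
          using b psubset.prems i by (simp add: represents_unit_def)
      qed
      then have "represents_unit A j (S - {l}) d"
        by (simp add: represents_unit_def)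
      with psubset.IH[of "S - {l}" d] l show ?thesis by blast
    qed
  qed
  with that show thesis by blast
qed

lemma spark_witness_if_represents_unit:
  fixes A :: "'a :: field mat"
  assumes j: "j < dim_row A" and S: "S \<subseteq> {..<dim_col A}" and c: "represents_unit A j S c"
  obtains T where "T \<subseteq> S" "\<not> lin_indep_columns (delete_row A j) T" "lin_indep_columns A T"
proof -
  have "finite S" using S finite_subset by blast
  with c obtain T d where T: "T \<subseteq> S" "lin_indep_columns A T" and d: "represents_unit A j T d"
    using represents_unit_imp_independent by metis
  \<comment> \<open>Row \<open>j\<close> of the system has right-hand side 1, so \<open>d\<close> is
    not zero on all of \<open>T\<close>. The other rows have right-hand side 0, so \<open>d\<close>
    is a nontrivial relation once row \<open>j\<close> is deleted.\<close>
  have "(\<Sum>k\<in>T. d k * A $$ (j, k)) \<noteq> 0"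
    using d j by (simp add: represents_unit_def)
  then have "\<exists>k\<in>T. d k \<noteq> 0"
    by (metis (no_types, lifting) mult_eq_0_iff sum.neutral)
  then have "\<not> lin_indep_columns (delete_row A j) T"
    unfolding lin_indep_columns_delete_row[OF j order_trans[OF T(1) S]]
    using d by (auto simp: represents_unit_def intro!: exI[of _ d])
  with T that show thesis by blast
qed

lemma spark_at_le_card:
  fixes A :: "'a :: field mat"
  assumes "j < dim_row A" "S \<subseteq> {..<dim_col A}" "represents_unit A j S c"
  shows "spark_at j A \<le> card S"
proof -
  obtain T where T: "T \<subseteq> S" "\<not> lin_indep_columns (delete_row A j) T" "lin_indep_columns A T"
    using spark_witness_if_represents_unit assms by blast
  have "spark_at j A \<le> card T"
    unfolding spark_at_def by (rule Least_le) (use T assms(2) in blast)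
  also have "\<dots> \<le> card S"
    using T(1) assms(2) by (meson card_mono finite_lessThan finite_subset)
  finally show ?thesis .
qed

lemma represents_unit_on_spark_at:
  fixes A :: "'a :: field mat"
  assumes j: "j < dim_row A" and "S \<subseteq> {..<dim_col A}" "represents_unit A j S c"
  obtains T d where "T \<subseteq> {..<dim_col A}" "card T = spark_at j A" "represents_unit A j T d"
proof -
  \<comment> \<open>The given representation makes the set under \<open>LEAST\<close> nonempty, so
    the spark is attained by some \<open>T\<close>.\<close>
  have "\<exists>s. \<exists>T \<subseteq> {..<dim_col A}. card T = s \<and>
      \<not> lin_indep_columns (delete_row A j) T \<and> lin_indep_columns A T"
    using spark_witness_if_represents_unit[OF assms] assms(2) by (metis order_trans)
  from LeastI_ex[OF this] obtain T where T: "T \<subseteq> {..<dim_col A}" "card T = spark_at j A"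
    and dep: "\<not> lin_indep_columns (delete_row A j) T" and indep: "lin_indep_columns A T"
    unfolding spark_at_def by blast
  from dep obtain b where b: "\<forall>i < dim_row A. i \<noteq> j \<longrightarrow> (\<Sum>k\<in>T. b k * A $$ (i, k)) = 0"
    and nz: "\<exists>k\<in>T. b k \<noteq> 0"
    unfolding lin_indep_columns_delete_row[OF j T(1)] by blast
  \<comment> \<open>The combination with coefficients \<open>b\<close> equals \<open>s\<close> times
    the unit vector \<open>j\<close>. Independence of the full columns forces \<open>s\<close> to be
    nonzero, and dividing by it gives the representation.\<close>
  define s where "s = (\<Sum>k\<in>T. b k * A $$ (j, k))"
  have "s \<noteq> 0"
  proof
    assume "s = 0"
    with b have "\<forall>i < dim_row A. (\<Sum>k\<in>T. b k * A $$ (i, k)) = 0"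
      unfolding s_def by blast
    with indep nz show False unfolding lin_indep_columns_def by blast
  qed
  have "(\<Sum>k\<in>T. b k / s * A $$ (i, k)) = (\<Sum>k\<in>T. b k * A $$ (i, k)) / s" for i
    by (simp add: sum_divide_distrib)
  then have "represents_unit A j T (\<lambda>k. b k / s)"
    using b \<open>s \<noteq> 0\<close> by (auto simp: represents_unit_def s_def[symmetric])
  with T that show thesis by blast
qed

section \<open>Sparsity and duality, row by row\<close>

lemma num_nonzero_eq_sum_rows:
  assumes "A \<in> carrier_mat n m"
  shows "num_nonzero A = (\<Sum>j<n. card {k. k < m \<and> A $$ (j, k) \<noteq> 0})"
proof -
  have "{(i, k). i < dim_row A \<and> k < dim_col A \<and> A $$ (i, k) \<noteq> 0} =
      (SIGMA j:{..<n}. {k. k < m \<and> A $$ (j, k) \<noteq> 0})"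
    using assms by auto
  then show ?thesis
    by (simp add: num_nonzero_def)
qed

lemma conjugate_sum:
  fixes f :: "'b \<Rightarrow> 'a :: conjugatable_ring"
  shows "conjugate (sum f S) = (\<Sum>x\<in>S. conjugate (f x))"
  by (induction S rule: infinite_finite_induct) (auto simp: conjugate_dist_add)

lemma conjugate_one: "conjugate (1 :: 'a :: conjugatable_field) = 1"
  by (metis conjugate_dist_mul conjugate_id mult.right_neutral mult.left_neutral)

lemma mult_mat_adjoint_index:
  assumes "\<Phi> \<in> carrier_mat n m" "\<Psi> \<in> carrier_mat n' m" "j < n'" "i < n"
  shows "(\<Psi> * mat_adjoint \<Phi>) $$ (j, i) = (\<Sum>k<m. \<Psi> $$ (j, k) * conjugate (\<Phi> $$ (i, k)))"
  using assms
  by (auto simp: scalar_prod_def mat_adjoint_def mat_of_rows_def atLeast0LessThan intro!: sum.cong)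

text \<open>Conjugating each entry of the product moves the conjugation from \<Phi> to \<Psi>, so
  that the columns of \<Phi> itself are combined. The entries 0 and 1 of the identity are fixed by
  conjugation.\<close>

lemma mult_mat_adjoint_eq_one_iff:
  fixes \<Phi> \<Psi> :: "'a :: conjugatable_field mat"
  assumes \<Phi>: "\<Phi> \<in> carrier_mat n m" and \<Psi>: "\<Psi> \<in> carrier_mat n m"
  shows "\<Psi> * mat_adjoint \<Phi> = 1\<^sub>m n \<longleftrightarrow>
    (\<forall>j<n. represents_unit \<Phi> j {..<m} (\<lambda>k. conjugate (\<Psi> $$ (j, k))))"
proof -
  have conj: "conjugate ((\<Psi> * mat_adjoint \<Phi>) $$ (j, i)) =
      (\<Sum>k<m. conjugate (\<Psi> $$ (j, k)) * \<Phi> $$ (i, k))" if "j < n" "i < n" for i j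
    using mult_mat_adjoint_index[OF \<Phi> \<Psi> that] by (simp add: conjugate_sum conjugate_dist_mul)
  have "\<Psi> * mat_adjoint \<Phi> = 1\<^sub>m n \<longleftrightarrow>
      (\<forall>j<n. \<forall>i<n. (\<Psi> * mat_adjoint \<Phi>) $$ (j, i) = (if i = j then 1 else 0))"
    using assms by (auto simp: mat_eq_iff mat_adjoint_def)
  also have "\<dots> \<longleftrightarrow> (\<forall>j<n. \<forall>i<n. conjugate ((\<Psi> * mat_adjoint \<Phi>) $$ (j, i)) =
      conjugate (if i = j then 1 else 0))"
    by (simp only: conjugate_cancel_iff)
  also have "\<dots> \<longleftrightarrow> (\<forall>j<n. \<forall>i<n. (\<Sum>k<m. conjugate (\<Psi> $$ (j, k)) * \<Phi> $$ (i, k)) =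
      (if i = j then 1 else 0))"
    by (simp add: conj if_distrib[of conjugate] conjugate_one cong: if_cong)
  finally show ?thesis
    using \<Phi> by (simp add: represents_unit_def)
qed

section \<open>Solutions of the duality equation are frames\<close>

lemma norm_sum_mult_squared_le:
  fixes f g :: "'b \<Rightarrow> 'a :: real_normed_field"
  shows "(norm (\<Sum>k\<in>S. f k * g k))\<^sup>2 \<le> (\<Sum>k\<in>S. (norm (f k))\<^sup>2) * (\<Sum>k\<in>S. (norm (g k))\<^sup>2)"
proof -
  \<comment> \<open>The scalar class provides a multiplicative norm but no inner product, so
    Cauchy-Schwarz is reduced by the triangle inequality to the real case, applied to the
    norms.\<close>
  have "norm (\<Sum>k\<in>S. f k * g k) \<le> (\<Sum>k\<in>S. \<bar>norm (f k)\<bar> * \<bar>norm (g k)\<bar>)"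
    by (rule order_trans[OF norm_sum]) (simp add: norm_mult)
  also have "\<dots> \<le> L2_set (\<lambda>k. norm (f k)) S * L2_set (\<lambda>k. norm (g k)) S"
    by (rule L2_set_mult_ineq)
  finally have "(norm (\<Sum>k\<in>S. f k * g k))\<^sup>2 \<le>
      (L2_set (\<lambda>k. norm (f k)) S * L2_set (\<lambda>k. norm (g k)) S)\<^sup>2"
    by (simp add: power_mono)
  then show ?thesis
    by (simp add: power_mult_distrib L2_set_def sum_nonneg)
qed

text \<open>Cauchy-Schwarz gives the upper bound directly. For the lower bound, the duality equation
  recovers \<open>x\<close> from its coefficients against the columns of \<Psi>, so these cannot be
  small unless \<open>x\<close> is. The sort leaves \<open>norm\<close> and \<open>conjugate\<close>
  unrelated; \<open>norm_conj\<close> connects them.\<close>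

lemma is_frame_if_mult_mat_adjoint_eq_one:
  fixes \<Phi> \<Psi> :: "'a :: {real_normed_field, conjugatable_field} mat"
  assumes norm_conj: "\<And>z :: 'a. norm (conjugate z) = norm z"
    and \<Phi>: "\<Phi> \<in> carrier_mat n m" and \<Psi>: "\<Psi> \<in> carrier_mat n m"
    and dual: "\<Psi> * mat_adjoint \<Phi> = 1\<^sub>m n"
  shows "is_frame n m \<Psi>"
proof -
  \<comment> \<open>\<open>F\<close> and \<open>G\<close> are the squared Frobenius norms of \<Phi>
    and \<Psi>. Adding 1 to each below keeps the frame bounds positive in degenerate dimensions and
    orders them, since 1/(F+1) <= 1 <= G+1.\<close>
  define F where "F = (\<Sum>i<n. \<Sum>k<m. (norm (\<Phi> $$ (i, k)))\<^sup>2)"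
  define G where "G = (\<Sum>k<m. \<Sum>j<n. (norm (\<Psi> $$ (j, k)))\<^sup>2)"
  have nonneg: "F \<ge> 0" "G \<ge> 0"
    by (simp_all add: F_def G_def sum_nonneg)
  have "1 / (F + 1) * (L2_set (\<lambda>i. norm (x $ i)) {..<n})\<^sup>2 \<le> (\<Sum>k<m. (norm (x \<bullet>c col \<Psi> k))\<^sup>2) \<and>
        (\<Sum>k<m. (norm (x \<bullet>c col \<Psi> k))\<^sup>2) \<le> (G + 1) * (L2_set (\<lambda>i. norm (x $ i)) {..<n})\<^sup>2"
    if x: "x \<in> carrier_vec n" for x
  proof -
    define N where "N = (\<Sum>i<n. (norm (x $ i))\<^sup>2)"
    define Y where "Y = (\<Sum>k<m. (norm (x \<bullet>c col \<Psi> k))\<^sup>2)"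
    have NY: "N \<ge> 0" "Y \<ge> 0" by (simp_all add: N_def Y_def sum_nonneg)
    have N: "(L2_set (\<lambda>i. norm (x $ i)) {..<n})\<^sup>2 = N"
      by (simp add: L2_set_def N_def sum_nonneg)
    have y: "x \<bullet>c col \<Psi> k = (\<Sum>j<n. x $ j * conjugate (\<Psi> $$ (j, k)))" if "k < m" for k
      using that x \<Psi> by (auto simp: scalar_prod_def atLeast0LessThan intro!: sum.cong)
    have "(norm (x $ i))\<^sup>2 \<le> (\<Sum>k<m. (norm (\<Phi> $$ (i, k)))\<^sup>2) * Y" if i: "i < n" for i
    proof -
      \<comment> \<open>The Kronecker delta is replaced by entries of the dual product. Swapping the
        sums then expresses \<open>x $ i\<close> through the frame coefficients of
        \<open>x\<close>.\<close>
      have "x $ i = (\<Sum>j<n. x $ j * (if i = j then 1 else 0))"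
        using i by (simp add: if_distrib[of "\<lambda>z. _ * z"] cong: if_cong)
      also have "\<dots> = (\<Sum>j<n. x $ j * (\<Sum>k<m. conjugate (\<Psi> $$ (j, k)) * \<Phi> $$ (i, k)))"
        using dual i \<Phi> unfolding mult_mat_adjoint_eq_one_iff[OF \<Phi> \<Psi>]
        by (auto simp: represents_unit_def intro!: sum.cong)
      also have "\<dots> = (\<Sum>k<m. \<Phi> $$ (i, k) * (\<Sum>j<n. x $ j * conjugate (\<Psi> $$ (j, k))))"
        unfolding sum_distrib_left by (subst sum.swap) (simp add: mult_ac)
      also have "\<dots> = (\<Sum>k<m. \<Phi> $$ (i, k) * (x \<bullet>c col \<Psi> k))"
        by (simp add: y)
      finally show ?thesis
        unfolding Y_def by (simp only: norm_sum_mult_squared_le)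
    qed
    then have "N \<le> F * Y"
      unfolding N_def F_def sum_distrib_right by (intro sum_mono) simp
    then have lower: "1 / (F + 1) * N \<le> Y"
      using nonneg NY by (simp add: field_simps)
    have "(norm (x \<bullet>c col \<Psi> k))\<^sup>2 \<le> (\<Sum>j<n. (norm (\<Psi> $$ (j, k)))\<^sup>2) * N" if "k < m" for k
      using norm_sum_mult_squared_le[of "\<lambda>j. x $ j" "\<lambda>j. conjugate (\<Psi> $$ (j, k))" "{..<n}"]
      by (simp add: y that norm_conj N_def mult.commute)
    then have "Y \<le> G * N"
      unfolding Y_def G_def sum_distrib_right by (intro sum_mono) simp
    then have "Y \<le> (G + 1) * N"
      using NY by (simp add: algebra_simps)
    with lower show ?thesis unfolding N Y_def by blast
  qed
  moreover have "0 < 1 / (F + 1)" "1 / (F + 1) \<le> G + 1"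
    using nonneg by (auto simp: field_simps intro: add_increasing2)
  ultimately show ?thesis
    unfolding is_frame_def using \<Psi> by blast
qed

section \<open>Comparing the rows of a dual with the sparks\<close>

lemma spark_at_le_card_row:
  fixes \<Phi> \<Psi> :: "'a :: conjugatable_field mat"
  assumes \<Phi>: "\<Phi> \<in> carrier_mat n m" and \<Psi>: "\<Psi> \<in> carrier_mat n m"
    and dual: "\<Psi> * mat_adjoint \<Phi> = 1\<^sub>m n" and j: "j < n"
  shows "spark_at j \<Phi> \<le> card {k. k < m \<and> \<Psi> $$ (j, k) \<noteq> 0}"
proof -
  let ?S = "{k. k < m \<and> \<Psi> $$ (j, k) \<noteq> 0}"
  \<comment> \<open>Zero entries contribute nothing, so row \<open>j\<close> already represents the
    unit vector on its support, whose size then bounds the spark.\<close>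
  have "(\<Sum>k\<in>?S. conjugate (\<Psi> $$ (j, k)) * \<Phi> $$ (i, k)) =
      (\<Sum>k<m. conjugate (\<Psi> $$ (j, k)) * \<Phi> $$ (i, k))" for i
    by (rule sum.mono_neutral_left) auto
  then have "represents_unit \<Phi> j ?S (\<lambda>k. conjugate (\<Psi> $$ (j, k)))"
    using dual j unfolding mult_mat_adjoint_eq_one_iff[OF \<Phi> \<Psi>] by (simp add: represents_unit_def)
  then show ?thesis
    by (rule spark_at_le_card[rotated 2]) (use \<Phi> j in auto)
qed

text \<open>The given dual shows that every unit vector is representable. Each row can then be
  replaced by a representation on a set of spark size, independently of the other rows.\<close>

lemma ex_dual_num_nonzero_le_sum_spark_at:
  fixes \<Phi> \<Psi> :: "'a :: conjugatable_field mat"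
  assumes \<Phi>: "\<Phi> \<in> carrier_mat n m" and \<Psi>: "\<Psi> \<in> carrier_mat n m"
    and dual: "\<Psi> * mat_adjoint \<Phi> = 1\<^sub>m n"
  obtains \<Psi>' where "\<Psi>' \<in> carrier_mat n m" "\<Psi>' * mat_adjoint \<Phi> = 1\<^sub>m n"
    "num_nonzero \<Psi>' \<le> (\<Sum>j<n. spark_at j \<Phi>)"
proof -
  have "\<exists>T d. T \<subseteq> {..<m} \<and> card T = spark_at j \<Phi> \<and> represents_unit \<Phi> j T d" if "j < n" for j
  proof -
    have dims: "dim_row \<Phi> = n" "dim_col \<Phi> = m" using \<Phi> by auto
    have "represents_unit \<Phi> j {..<m} (\<lambda>k. conjugate (\<Psi> $$ (j, k)))"
      using dual that unfolding mult_mat_adjoint_eq_one_iff[OF \<Phi> \<Psi>] by blast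
    from represents_unit_on_spark_at[of j \<Phi>, unfolded dims, OF that subset_refl this]
    show ?thesis by blast
  qed
  then obtain T d where T: "\<And>j. j < n \<Longrightarrow> T j \<subseteq> {..<m}" "\<And>j. j < n \<Longrightarrow> card (T j) = spark_at j \<Phi>"
    and d: "\<And>j. j < n \<Longrightarrow> represents_unit \<Phi> j (T j) (d j)"
    by metis
  define \<Psi>' where "\<Psi>' = mat n m (\<lambda>(j, k). if k \<in> T j then conjugate (d j k) else 0)"
  have \<Psi>': "\<Psi>' \<in> carrier_mat n m" by (simp add: \<Psi>'_def)
  have "represents_unit \<Phi> j {..<m} (\<lambda>k. conjugate (\<Psi>' $$ (j, k)))" if j: "j < n" for j
  proof -
    have "(\<Sum>k<m. conjugate (\<Psi>' $$ (j, k)) * \<Phi> $$ (i, k)) = (\<Sum>k\<in>T j. d j k * \<Phi> $$ (i, k))" for i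
      by (rule sum.mono_neutral_cong_right) (use T(1)[OF j] j in \<open>auto simp: \<Psi>'_def\<close>)
    then show ?thesis
      using d[OF j] by (simp add: represents_unit_def)
  qed
  then have "\<Psi>' * mat_adjoint \<Phi> = 1\<^sub>m n"
    using mult_mat_adjoint_eq_one_iff[OF \<Phi> \<Psi>'] by blast
  \<comment> \<open>An inequality suffices here, so zeros of \<open>d j\<close> on
    \<open>T j\<close> need not be excluded.\<close>
  moreover have "card {k. k < m \<and> \<Psi>' $$ (j, k) \<noteq> 0} \<le> spark_at j \<Phi>" if j: "j < n" for j
    unfolding T(2)[OF j, symmetric]
    by (rule card_mono, rule finite_subset[OF T(1)[OF j]])
      (use j in \<open>auto simp: \<Psi>'_def split: if_splits\<close>)
  then have "num_nonzero \<Psi>' \<le> (\<Sum>j<n. spark_at j \<Phi>)"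
    unfolding num_nonzero_eq_sum_rows[OF \<Psi>'] by (intro sum_mono) simp
  ultimately show thesis using that \<Psi>' by blast
qed

text \<open>The sparsest dual has two roles: its rows give the lower bound, and its existence
  provides the competitor for the upper bound. Assuming \<open>norm_conj\<close> over general
  scalars treats the real and complex cases together.\<close>

lemma num_nonzero_sparsest_dual:
  fixes \<Phi> \<Psi> :: "'a :: {real_normed_field, conjugatable_field} mat"
  assumes norm_conj: "\<And>z :: 'a. norm (conjugate z) = norm z"
    and frame: "is_frame n m \<Phi>" and sparsest: "is_sparsest_dual n m \<Phi> \<Psi>"
  shows "num_nonzero \<Psi> = (\<Sum>j<n. spark_at j \<Phi>)"
proof (rule antisym)
  have \<Phi>: "\<Phi> \<in> carrier_mat n m" and \<Psi>: "\<Psi> \<in> carrier_mat n m"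
    and dual: "\<Psi> * mat_adjoint \<Phi> = 1\<^sub>m n"
    using frame sparsest
    by (auto simp: is_sparsest_dual_def is_arg_min_def is_dual_frame_def is_frame_def)
  show "(\<Sum>j<n. spark_at j \<Phi>) \<le> num_nonzero \<Psi>"
    unfolding num_nonzero_eq_sum_rows[OF \<Psi>]
    by (intro sum_mono spark_at_le_card_row[OF \<Phi> \<Psi> dual]) simp
  obtain \<Psi>' where "\<Psi>' \<in> carrier_mat n m" "\<Psi>' * mat_adjoint \<Phi> = 1\<^sub>m n"
    and le: "num_nonzero \<Psi>' \<le> (\<Sum>j<n. spark_at j \<Phi>)"
    using ex_dual_num_nonzero_le_sum_spark_at[OF \<Phi> \<Psi> dual] .
  then have "is_dual_frame n m \<Phi> \<Psi>'"
    using is_frame_if_mult_mat_adjoint_eq_one[OF norm_conj \<Phi>] by (simp add: is_dual_frame_def)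
  then have "num_nonzero \<Psi> \<le> num_nonzero \<Psi>'"
    using sparsest by (auto simp: is_sparsest_dual_def is_arg_min_linorder)
  with le show "num_nonzero \<Psi> \<le> (\<Sum>j<n. spark_at j \<Phi>)" by simp
qed

theorem proposition3p3:
  fixes n m :: nat
  shows "(\<forall>\<Phi> \<Psi> :: real mat. is_frame n m \<Phi> \<longrightarrow> is_sparsest_dual n m \<Phi> \<Psi> \<longrightarrow>
            num_nonzero \<Psi> = (\<Sum>j<n. spark_at j \<Phi>)) \<and>
         (\<forall>\<Phi> \<Psi> :: complex mat. is_frame n m \<Phi> \<longrightarrow> is_sparsest_dual n m \<Phi> \<Psi> \<longrightarrow>
            num_nonzero \<Psi> = (\<Sum>j<n. spark_at j \<Phi>))"
  by (intro conjI allI impI; rule num_nonzero_sparsest_dual) simp_all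

end
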